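(* Let $\alpha=\sqrt{F(x_0)(1-F(x_0))/g(x_0)}>0$ and $\beta=f(x_0)/2>0$, and for $c>0$ let $\mathcal S_c=\mathbb X_{c,\alpha,\beta}(0)$. Then, as $c\to\infty$, $$\sqrt{c}\,\mathcal S_c\ \xrightarrow{d}\ \alpha Z,$$ where $Z$ has the standard normal distribution.
   Context: $F$ is a distribution function with density $f$, $g$ is a density, and $x_0$ is a fixed point with $0<F(x_0)<1$, $f(x_0)>0$, $g(x_0)>0$; these enter only through the positive constants $\alpha$ and $\beta$. For $c,\kappa_1,\kappa_2>0$ and $W$ a standard two-sided Brownian motion with $W(0)=0$, let $\mathcal P_{c,\kappa_1,\kappa_2}(k)=\big(ck,\ \kappa_1W(ck)+\kappa_2c^2k(1+k)\big)\in\mathbb R^2$, $k\in\mathbb Z$. $\mathbb X_{c,\kappa_1,\kappa_2}(0)$ is the left derivative at $0$ of the greatest convex minorant (a piecewise linear convex function on $\mathbb R$) of the point set $\{\mathcal P_{c,\kappa_1,\kappa_2}(k):k\in\mathbb Z\}$. *)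

theory Defs
  imports "HOL-Probability.Probability"
begin

definition prob_density :: "(real \<Rightarrow> real) \<Rightarrow> bool" where
  "prob_density f \<longleftrightarrow>
     f \<in> borel_measurable borel \<and> (\<forall>x. 0 \<le> f x) \<and>
     prob_space (density lborel (\<lambda>x. ennreal (f x)))"

definition dist_fun_with_density :: "(real \<Rightarrow> real) \<Rightarrow> (real \<Rightarrow> real) \<Rightarrow> bool" where
  "dist_fun_with_density F f \<longleftrightarrow>
     prob_density f \<and> F = cdf (density lborel (\<lambda>x. ennreal (f x)))"

(* The time parameter ranges over all of the reals, so independence of the increments over
   arbitrary increasing finite families of times covers both halves of the path and their
   mutual independence. *)
definition two_sided_brownian_motion :: "'a measure \<Rightarrow> (real \<Rightarrow> 'a \<Rightarrow> real) \<Rightarrow> bool" where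
  "two_sided_brownian_motion M W \<longleftrightarrow>
     prob_space M \<and>
     (\<forall>t. W t \<in> borel_measurable M) \<and>
     (AE \<omega> in M. W 0 \<omega> = 0) \<and>
     (\<forall>(t :: nat \<Rightarrow> real) n. strict_mono_on {..n} t \<longrightarrow>
        prob_space.indep_vars M (\<lambda>_. borel) (\<lambda>i \<omega>. W (t (Suc i)) \<omega> - W (t i) \<omega>) {..<n}) \<and>
     (\<forall>s t. s < t \<longrightarrow>
        distributed M lborel (\<lambda>\<omega>. W t \<omega> - W s \<omega>) (normal_density 0 (sqrt (t - s)))) \<and>
     (AE \<omega> in M. continuous_on UNIV (\<lambda>t. W t \<omega>))"

(* If A has no convex minorant, the supremum is Sup {}, an unspecified constant independent of x.
   For the point sets below this can happen only for a null set of paths. *)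
definition greatest_convex_minorant :: "(real \<times> real) set \<Rightarrow> real \<Rightarrow> real" where
  "greatest_convex_minorant A x =
     Sup {h x | h. convex_on UNIV h \<and> (\<forall>(t, y) \<in> A. h t \<le> y)}"

definition left_derivative :: "(real \<Rightarrow> real) \<Rightarrow> real \<Rightarrow> real" where
  "left_derivative h x = (THE D. (h has_real_derivative D) (at_left x))"

(* w is a single sample path of the Brownian motion. *)
definition grid_point ::
    "(real \<Rightarrow> real) \<Rightarrow> real \<Rightarrow> real \<Rightarrow> real \<Rightarrow> int \<Rightarrow> real \<times> real" where
  "grid_point w c \<kappa>\<^sub>1 \<kappa>\<^sub>2 k =
     (c * of_int k, \<kappa>\<^sub>1 * w (c * of_int k) + \<kappa>\<^sub>2 * c\<^sup>2 * of_int k * (1 + of_int k))"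

definition gcm_slope ::
    "(real \<Rightarrow> real) \<Rightarrow> real \<Rightarrow> real \<Rightarrow> real \<Rightarrow> real \<Rightarrow> real" where
  "gcm_slope w c \<kappa>\<^sub>1 \<kappa>\<^sub>2 =
     left_derivative (greatest_convex_minorant (range (grid_point w c \<kappa>\<^sub>1 \<kappa>\<^sub>2)))"

(* The analogue of weak_conv_m for families of laws indexed along an arbitrary filter. *)
definition weak_conv_along :: "'i filter \<Rightarrow> ('i \<Rightarrow> real measure) \<Rightarrow> real measure \<Rightarrow> bool" where
  "weak_conv_along E \<mu> \<nu> \<longleftrightarrow>
     (\<forall>x. isCont (cdf \<nu>) x \<longrightarrow> ((\<lambda>i. cdf (\<mu> i) x) \<longlongrightarrow> cdf \<nu> x) E)"

end

(* For large c the drift makes the points of index other than 0 and -1 irrelevant: on the event that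
   |W(ck) - W(0)| < e c^2 k^2 for all k other than 0, with e = beta / (4 alpha), the segment joining
   the points of index -1 and 0 is a face of the minorant, so that the left slope at 0 is exactly
   alpha (W(0) - W(-c)) / c, and sqrt c times this is distributed like alpha Z. By Chebyshev's
   inequality and a union bound over k, the complementary event has probability O(c^-3).
   The slope is measurable on the whole space because, off the event that there is no minorant, the
   minorant at x is at least t iff (x, t) lies below the countably many chords between data points. *)

theory Submission
  imports Defs
begin

section \<open>Convex minorants and the chords of a planar point set\<close>

definition convex_minorant :: "(real \<Rightarrow> real) \<Rightarrow> (real \<times> real) set \<Rightarrow> bool" where
  "convex_minorant h A \<longleftrightarrow> convex_on UNIV h \<and> (\<forall>(t, y) \<in> A. h t \<le> y)"

text \<open>The chord inequality is multiplied out by \<open>q - p\<close>, which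
  \<open>x < q\<close> keeps positive. Allowing \<open>p = x\<close> lets a data point lying over
  \<open>x\<close> itself act as a constraint.\<close>

definition below_chords :: "(real \<times> real) set \<Rightarrow> real \<Rightarrow> real \<Rightarrow> bool" where
  "below_chords A x t \<longleftrightarrow>
     (\<forall>(p, y) \<in> A. \<forall>(q, z) \<in> A. p \<le> x \<longrightarrow> x < q \<longrightarrow> t * (q - p) \<le> y * (q - x) + z * (x - p))"

text \<open>Ensures a chord over every \<open>x\<close>, so that the values of minorants at
  \<open>x\<close> are bounded above and the supremum of reals is meaningful.\<close>

definition two_sided :: "(real \<times> real) set \<Rightarrow> bool" where
  "two_sided A \<longleftrightarrow> (\<forall>x. (\<exists>(p, y) \<in> A. p < x) \<and> (\<exists>(q, z) \<in> A. x < q))"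

lemma greatest_convex_minorant_eq:
  "greatest_convex_minorant A x = Sup {h x | h. convex_minorant h A}"
  by (simp add: greatest_convex_minorant_def convex_minorant_def)

lemma convex_on_chord:
  fixes h :: "real \<Rightarrow> real"
  assumes "convex_on UNIV h" "p \<le> x" "x < q"
  shows "h x * (q - p) \<le> h p * (q - x) + h q * (x - p)"
proof -
  define u where "u = (x - p) / (q - p)"
  have qp: "q - p > 0" and u: "0 \<le> u" "u \<le> 1" and up: "u * (q - p) = x - p"
    using assms by (auto simp: u_def field_simps)
  have x: "x = (1 - u) *\<^sub>R p + u *\<^sub>R q"
    using up by (simp add: algebra_simps)
  have "h x \<le> (1 - u) * h p + u * h q"
    by (subst x) (rule convex_onD[OF assms(1) u], auto)
  hence "h x * (q - p) \<le> ((1 - u) * h p + u * h q) * (q - p)"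
    using qp by (intro mult_right_mono) auto
  also have "\<dots> = h p * ((q - p) - u * (q - p)) + h q * (u * (q - p))"
    by (simp add: algebra_simps)
  finally show ?thesis using up by simp
qed

lemma convex_on_affine:
  fixes a b :: real
  shows "convex_on UNIV (\<lambda>x. b + a * (x - z))"
  by (rule f''_ge0_imp_convex[where f' = "\<lambda>_. a" and f'' = "\<lambda>_. 0"])
     (auto intro!: derivative_eq_intros)

text \<open>\<open>h\<close> lies below its own chord, and raising the end points to the data
  preserves the inequality because the weights \<open>q - x\<close> and \<open>x - p\<close> are
  nonnegative.\<close>

lemma convex_minorant_below_chords:
  assumes "convex_minorant h A"
  shows "below_chords A x (h x)"
  unfolding below_chords_def
proof (safe)
  fix p y q z assume A: "(p, y) \<in> A" "(q, z) \<in> A" and "p \<le> x" "x < q"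
  hence "h x * (q - p) \<le> h p * (q - x) + h q * (x - p)"
    using assms by (intro convex_on_chord) (auto simp: convex_minorant_def)
  also have "h p * (q - x) \<le> y * (q - x)"
    using assms A \<open>x < q\<close> by (intro mult_right_mono) (auto simp: convex_minorant_def)
  also have "h q * (x - p) \<le> z * (x - p)"
    using assms A \<open>p \<le> x\<close> by (intro mult_right_mono) (auto simp: convex_minorant_def)
  finally show "h x * (q - p) \<le> y * (q - x) + z * (x - p)" by simp
qed

lemma below_chords_mono: "below_chords A x t \<Longrightarrow> s \<le> t \<Longrightarrow> below_chords A x s"
  unfolding below_chords_def
proof (safe, goal_cases)
  case (1 p y q z)
  hence "s * (q - p) \<le> t * (q - p)" by (intro mult_right_mono) auto
  also have "\<dots> \<le> y * (q - x) + z * (x - p)" using 1 by blast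
  finally show ?case .
qed

lemma below_chords_bounded:
  assumes "two_sided A"
  obtains B where "\<And>t. below_chords A x t \<Longrightarrow> t \<le> B"
proof -
  from assms obtain p y q z where A: "(p, y) \<in> A" "p < x" "(q, z) \<in> A" "x < q"
    unfolding two_sided_def by blast
  show ?thesis
  proof
    fix t assume "below_chords A x t"
    hence "t * (q - p) \<le> y * (q - x) + z * (x - p)"
      using A unfolding below_chords_def by (fastforce dest: bspec)
    thus "t \<le> (y * (q - x) + z * (x - p)) / (q - p)"
      using A by (simp add: pos_le_divide_eq)
  qed
qed

text \<open>The slopes of the lines joining \<open>(x, t)\<close> to points of \<open>A\<close> on the left are bounded by those
  to points on the right, so any slope in between gives an affine minorant through \<open>(x, t)\<close>.\<close>

lemma below_chords_imp_convex_minorant: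
  assumes "two_sided A" "below_chords A x t"
  obtains h where "convex_minorant h A" "h x = t"
proof -
  define L where "L = {(t - y) / (x - p) | p y. (p, y) \<in> A \<and> p < x}"
  \<comment> \<open>Two-sidedness makes \<open>L\<close> nonempty and, through \<open>L_le\<close>,
    bounded by a slope on the right; hence the supremum separates left slopes from right
    slopes.\<close>
  define a where "a = Sup L"
  have L_le: "l \<le> (z - t) / (q - x)" if "l \<in> L" "(q, z) \<in> A" "x < q" for l q z
  proof -
    from that obtain p y where p: "l = (t - y) / (x - p)" "(p, y) \<in> A" "p < x"
      by (auto simp: L_def)
    have "t * (q - p) \<le> y * (q - x) + z * (x - p)"
      using assms(2) p that unfolding below_chords_def by fastforce
    hence "(t - y) * (q - x) \<le> (z - t) * (x - p)" by (simp add: algebra_simps)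
    thus ?thesis using p(3) that(3) by (simp add: p(1) pos_divide_le_eq pos_le_divide_eq mult.commute)
  qed
  have ne: "L \<noteq> {}" using assms(1) by (fastforce simp: two_sided_def L_def)
  have bdd: "bdd_above L"
    using assms(1) L_le by (fastforce simp: two_sided_def bdd_above_def)
  have "convex_minorant (\<lambda>z. t + a * (z - x)) A"
    unfolding convex_minorant_def
  proof (safe)
    show "convex_on UNIV (\<lambda>z. t + a * (z - x))" by (rule convex_on_affine)
    fix p y assume A: "(p, y) \<in> A"
    consider "p < x" | "p = x" | "p > x" by linarith
    thus "t + a * (p - x) \<le> y"
    proof cases
      case 1
      hence "(t - y) / (x - p) \<le> a"
        unfolding a_def using A bdd by (intro cSup_upper) (auto simp: L_def)
      thus ?thesis using 1 by (simp add: field_simps)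
    next
      \<comment> \<open>For a data point over \<open>x\<close>, any point further right gives a
        degenerate chord whose inequality reduces to \<open>t \<le> y\<close>.\<close>
      case 2
      obtain q z where q: "(q, z) \<in> A" "x < q" using assms(1) unfolding two_sided_def by blast
      have "t * (q - p) \<le> y * (q - x) + z * (x - p)"
        using assms(2) A q 2 unfolding below_chords_def by fastforce
      thus ?thesis using 2 q by simp
    next
      case 3
      hence "a \<le> (y - t) / (p - x)"
        unfolding a_def using A ne L_le by (intro cSup_least) auto
      thus ?thesis using 3 by (simp add: field_simps)
    qed
  qed
  thus ?thesis using that by auto
qed

text \<open>Turns existence of a function into a countable condition at one arbitrary
  \<open>x\<close>, as measurability requires: a minorant exceeds some \<open>- real n\<close> at
  \<open>x\<close>, and conversely a point below all chords carries an affine minorant.\<close>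

lemma ex_convex_minorant_iff:
  assumes "two_sided A"
  shows "(\<exists>h. convex_minorant h A) \<longleftrightarrow> (\<exists>n::nat. below_chords A x (- real n))"
proof
  assume "\<exists>h. convex_minorant h A"
  then obtain h where h: "convex_minorant h A" ..
  obtain n :: nat where "- h x \<le> real n" using real_arch_simple by blast
  thus "\<exists>n::nat. below_chords A x (- real n)"
    using below_chords_mono[OF convex_minorant_below_chords[OF h]] by (metis minus_le_iff)
next
  assume "\<exists>n::nat. below_chords A x (- real n)"
  thus "\<exists>h. convex_minorant h A"
    using below_chords_imp_convex_minorant[OF assms] by blast
qed

lemma convex_minorant_le_gcm:
  assumes "two_sided A" "convex_minorant h A"
  shows "h x \<le> greatest_convex_minorant A x"
  unfolding greatest_convex_minorant_eq
proof (rule cSup_upper)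
  obtain B where "\<And>t. below_chords A x t \<Longrightarrow> t \<le> B"
    using below_chords_bounded[OF assms(1), of x] by blast
  thus "bdd_above {h x |h. convex_minorant h A}"
    using convex_minorant_below_chords by (intro bdd_aboveI[of _ B]) auto
qed (use assms in auto)

text \<open>The witness \<open>g\<close> makes the set under the supremum nonempty.\<close>

lemma gcm_le:
  assumes "convex_minorant g A" "\<And>h. convex_minorant h A \<Longrightarrow> h x \<le> B"
  shows "greatest_convex_minorant A x \<le> B"
  unfolding greatest_convex_minorant_eq using assms by (intro cSup_least) auto

text \<open>Convexity passes to pointwise suprema: in the inequality for a single \<open>h\<close>
  the right-hand side is first enlarged to the suprema, then the supremum is taken on the
  left.\<close>

lemma convex_minorant_gcm:
  assumes "two_sided A" "convex_minorant g A"
  shows "convex_minorant (greatest_convex_minorant A) A"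
  unfolding convex_minorant_def
proof safe
  show "convex_on UNIV (greatest_convex_minorant A)"
  proof (rule convex_onI)
    fix u x y :: real assume u: "0 < u" "u < 1"
    show "greatest_convex_minorant A ((1 - u) *\<^sub>R x + u *\<^sub>R y)
      \<le> (1 - u) * greatest_convex_minorant A x + u * greatest_convex_minorant A y"
    proof (rule gcm_le[OF assms(2)])
      fix h assume h: "convex_minorant h A"
      have "h ((1 - u) *\<^sub>R x + u *\<^sub>R y) \<le> (1 - u) * h x + u * h y"
        using h u by (intro convex_onD) (auto simp: convex_minorant_def)
      also have "\<dots> \<le> (1 - u) * greatest_convex_minorant A x + u * greatest_convex_minorant A y"
        using u by (intro add_mono mult_left_mono convex_minorant_le_gcm assms(1) h) auto
      finally show "h ((1 - u) *\<^sub>R x + u *\<^sub>R y)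
        \<le> (1 - u) * greatest_convex_minorant A x + u * greatest_convex_minorant A y" .
    qed
  qed auto
  fix t y assume "(t, y) \<in> A"
  thus "greatest_convex_minorant A t \<le> y"
    by (intro gcm_le[OF assms(2)]) (auto simp: convex_minorant_def)
qed

text \<open>Replaces a supremum over functions by inequalities between pairs of data points. One
  direction holds since the supremum is itself a minorant, the other since an affine minorant passes
  through \<open>(x, t)\<close>.\<close>

lemma le_gcm_iff:
  assumes "two_sided A" "convex_minorant g A"
  shows "t \<le> greatest_convex_minorant A x \<longleftrightarrow> below_chords A x t"
proof
  assume "t \<le> greatest_convex_minorant A x"
  thus "below_chords A x t"
    using below_chords_mono convex_minorant_below_chords[OF convex_minorant_gcm[OF assms]] by blast
next
  assume "below_chords A x t"
  then obtain h where "convex_minorant h A" "h x = t"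
    using below_chords_imp_convex_minorant[OF assms(1)] by blast
  thus "t \<le> greatest_convex_minorant A x" using convex_minorant_le_gcm[OF assms(1)] by blast
qed

lemma gcm_no_convex_minorant:
  assumes "\<nexists>h. convex_minorant h A"
  shows "greatest_convex_minorant A x = Sup {}"
proof -
  have "{h x | h. convex_minorant h A} = {}" using assms by auto
  thus ?thesis by (simp add: greatest_convex_minorant_eq)
qed

section \<open>Left derivatives of convex functions and of the minorant\<close>

text \<open>The difference quotient \<open>s\<close> increases as its argument approaches
  \<open>x\<close> from the left and is bounded there, so it converges to its supremum.\<close>

lemma convex_on_has_left_derivative:
  fixes h :: "real \<Rightarrow> real"
  assumes "convex_on UNIV h"
  obtains D where "(h has_real_derivative D) (at_left x)"
proof -
  define s where "s = (\<lambda>y. (h y - h x) / (y - x))"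
  have mono: "s y \<le> s z" if "y \<le> z" "z < x" for y z
  proof (cases "y = z")
    case False
    hence "h z * (x - y) \<le> h y * (x - z) + h x * (z - y)"
      using that by (intro convex_on_chord assms) auto
    hence "(h x - h y) * (x - z) \<le> (h x - h z) * (x - y)" by (simp add: algebra_simps)
    moreover have "s y = (h x - h y) / (x - y)" "s z = (h x - h z) / (x - z)"
      by (metis s_def minus_diff_eq minus_divide_divide)+
    ultimately show ?thesis
      using that by (simp add: pos_divide_le_eq pos_le_divide_eq)
  qed simp
  \<comment> \<open>The bound is the slope of the chord from \<open>x\<close> to
    \<open>x + 1\<close>, whose run is 1.\<close>
  have bound: "s y \<le> h (x + 1) - h x" if "y < x" for y
  proof -
    have "h x * (x + 1 - y) \<le> h y * (x + 1 - x) + h (x + 1) * (x - y)"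
      using that by (intro convex_on_chord assms) auto
    hence "h x - h y \<le> (h (x + 1) - h x) * (x - y)" by (simp add: algebra_simps)
    moreover have "s y = (h x - h y) / (x - y)"
      by (metis s_def minus_diff_eq minus_divide_divide)
    ultimately show ?thesis using that by (simp add: pos_divide_le_eq)
  qed
  have bdd: "bdd_above (s ` {..<x})" using bound by (auto simp: bdd_above_def)
  have "(s \<longlongrightarrow> Sup (s ` {..<x})) (at_left x)"
  proof (rule increasing_tendsto)
    have "eventually (\<lambda>y. y < x) (at_left x)" by (simp add: eventually_at_filter)
    thus "\<forall>\<^sub>F y in at_left x. s y \<le> Sup (s ` {..<x})"
      by eventually_elim (auto intro!: cSup_upper bdd)
  next
    fix l assume "l < Sup (s ` {..<x})"
    then obtain y where y: "y < x" "l < s y" by (subst (asm) less_cSup_iff) (auto simp: bdd)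
    have "eventually (\<lambda>z. z \<in> {y<..<x}) (at_left x)" using y by (intro eventually_at_left_real)
    thus "\<forall>\<^sub>F z in at_left x. l < s z"
      by eventually_elim (use y mono in \<open>auto intro: less_le_trans\<close>)
  qed
  thus ?thesis using that by (simp add: has_field_derivative_iff s_def)
qed

lemma left_derivative_eq:
  assumes "(h has_real_derivative D) (at_left x)"
  shows "left_derivative h x = D"
  unfolding left_derivative_def
proof (rule the_equality)
  show "(h has_real_derivative D) (at_left x)" by fact
next
  fix D' assume "(h has_real_derivative D') (at_left x)"
  thus "D' = D" using assms
    by (auto simp: has_field_derivative_iff intro: tendsto_unique[rotated])
qed

text \<open>Reduces measurability of the slope to that of the minorant at countably many
  places.\<close>

lemma left_derivative_gcm_LIMSEQ:
  assumes "two_sided A"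
  defines "G \<equiv> greatest_convex_minorant A"
  shows "(\<lambda>n. (G x - G (x - 1 / real (Suc n))) * real (Suc n)) \<longlonglongrightarrow> left_derivative G x"
proof -
  have "\<exists>D. (G has_real_derivative D) (at_left x)"
  proof (cases "\<exists>h. convex_minorant h A")
    case True
    hence "convex_on UNIV G"
      unfolding G_def using convex_minorant_gcm[OF assms(1)] by (auto simp: convex_minorant_def)
    thus ?thesis using convex_on_has_left_derivative by blast
  next
    \<comment> \<open>Without a minorant \<open>G\<close> is the constant \<open>Sup {}\<close>,
      which is still differentiable.\<close>
    case False
    hence "G = (\<lambda>_. Sup {})" unfolding G_def by (simp add: fun_eq_iff gcm_no_convex_minorant)
    thus ?thesis using DERIV_const by blast
  qed
  then obtain D where D: "(G has_real_derivative D) (at_left x)" ..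
  have "filterlim (\<lambda>n. x - 1 / real (Suc n)) (at_left x) sequentially"
    unfolding filterlim_at
  proof
    show "(\<lambda>n. x - 1 / real (Suc n)) \<longlonglongrightarrow> x"
      using tendsto_diff[OF tendsto_const LIMSEQ_inverse_real_of_nat, of x]
      by (simp add: inverse_eq_divide)
  qed auto
  from filterlim_compose[OF D[unfolded has_field_derivative_iff] this]
  have "(\<lambda>n. (G (x - 1 / real (Suc n)) - G x) / (x - 1 / real (Suc n) - x)) \<longlonglongrightarrow> D" .
  moreover have "(G (x - 1 / real (Suc n)) - G x) / (x - 1 / real (Suc n) - x)
      = (G x - G (x - 1 / real (Suc n))) * real (Suc n)" for n
    by (simp add: field_simps)
  ultimately show ?thesis using left_derivative_eq[OF D] by simp
qed

section \<open>Measurability of the minorant of the grid and of its slope\<close>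

lemma two_sided_grid:
  assumes "c > 0"
  shows "two_sided (range (grid_point w c a b))"
  unfolding two_sided_def
proof (intro allI conjI)
  fix x :: real
  obtain k :: int where "of_int k < x / c" using floor_less_iff ex_of_int_less by blast
  thus "\<exists>(p, y) \<in> range (grid_point w c a b). p < x"
    using assms by (auto simp: grid_point_def field_simps intro!: exI[of _ k])
  obtain k :: int where "x / c < of_int k" using ex_less_of_int by blast
  thus "\<exists>(q, z) \<in> range (grid_point w c a b). x < q"
    using assms by (auto simp: grid_point_def field_simps intro!: exI[of _ k])
qed

lemma measurable_gcm_grid:
  assumes W: "\<And>t. W t \<in> borel_measurable M" and "c > 0"
  shows "(\<lambda>\<omega>. greatest_convex_minorant (range (grid_point (\<lambda>t. W t \<omega>) c a b)) x) \<in> borel_measurable M"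
    (is "?G \<in> _")
proof -
  note W[measurable]
  define A where "A = (\<lambda>\<omega>. range (grid_point (\<lambda>t. W t \<omega>) c a b))"
  have ts: "two_sided (A \<omega>)" for \<omega> unfolding A_def by (rule two_sided_grid) fact
  have G_eq: "?G \<omega> = greatest_convex_minorant (A \<omega>) x" for \<omega> by (simp add: A_def)
  \<comment> \<open>Over the range of the grid the bounded quantifiers become quantifiers over
    integers, so the event is a countable intersection.\<close>
  have [measurable]: "Measurable.pred M (\<lambda>\<omega>. below_chords (A \<omega>) x t)" for t
    unfolding A_def below_chords_def grid_point_def by (simp, measurable)
  \<comment> \<open>The condition of the \<open>if\<close> is a countable union that detects
    existence of a minorant; where it fails, the default \<open>Sup {}\<close> does not depend on
    \<open>\<omega>\<close>.\<close>
  have "{\<omega> \<in> space M. t \<le> ?G \<omega>} =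
    {\<omega> \<in> space M. if \<exists>n::nat. below_chords (A \<omega>) x (- real n) then below_chords (A \<omega>) x t
       else t \<le> Sup {}}" for t
  proof (rule Collect_cong)
    fix \<omega>
    show "\<omega> \<in> space M \<and> t \<le> ?G \<omega> \<longleftrightarrow> \<omega> \<in> space M \<and>
      (if \<exists>n::nat. below_chords (A \<omega>) x (- real n) then below_chords (A \<omega>) x t else t \<le> Sup {})"
    proof (cases "\<exists>h. convex_minorant h (A \<omega>)")
      case True
      then obtain h where h: "convex_minorant h (A \<omega>)" ..
      show ?thesis
        unfolding G_eq le_gcm_iff[OF ts h] using ex_convex_minorant_iff[OF ts] True by simp
    next
      case False
      thus ?thesis
        unfolding G_eq gcm_no_convex_minorant[OF False]
        using ex_convex_minorant_iff[OF ts] by simp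
    qed
  qed
  moreover have "{\<omega> \<in> space M. if \<exists>n::nat. below_chords (A \<omega>) x (- real n)
    then below_chords (A \<omega>) x t else t \<le> Sup {}} \<in> sets M" for t
    by measurable
  ultimately show ?thesis by (subst borel_measurable_iff_ge) auto
qed

lemma measurable_gcm_slope:
  assumes "\<And>t. W t \<in> borel_measurable M" and "c > 0"
  shows "(\<lambda>\<omega>. gcm_slope (\<lambda>t. W t \<omega>) c a b x) \<in> borel_measurable M"
  unfolding gcm_slope_def
  by (rule borel_measurable_LIMSEQ_real[OF left_derivative_gcm_LIMSEQ[OF two_sided_grid[OF assms(2)]]])
     (intro borel_measurable_times borel_measurable_diff measurable_gcm_grid assms borel_measurable_const)

section \<open>The slope at 0 for paths with small increments\<close>

text \<open>By \<open>above\<close>, the line through the points of index -1 and 0 is a minorant;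
  the chord between them bounds every minorant by the same line on \<open>[-c, 0]\<close>.\<close>

lemma gcm_slope_eq_first_chord:
  assumes "c > 0"
    and above: "\<And>k. a * w 0 + a * (w 0 - w (- c)) * of_int k
      \<le> a * w (c * of_int k) + b * c\<^sup>2 * of_int k * (1 + of_int k)"
  shows "gcm_slope w c a b 0 = a * (w 0 - w (- c)) / c"
proof -
  define A where "A = range (grid_point w c a b)"
  define m where "m = a * (w 0 - w (- c)) / c"
  define l where "l = (\<lambda>x. a * w 0 + m * (x - 0))"
  have ts: "two_sided A" unfolding A_def by (rule two_sided_grid) fact
  have l: "convex_minorant l A"
    unfolding convex_minorant_def
  proof
    show "convex_on UNIV l" unfolding l_def by (rule convex_on_affine)
    show "\<forall>(t, y)\<in>A. l t \<le> y"
      using above \<open>c > 0\<close> by (auto simp: A_def grid_point_def l_def m_def mult.assoc)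
  qed
  \<comment> \<open>The drift factor \<open>k * (1 + k)\<close> vanishes at both indices.\<close>
  have P: "(- c, a * w (- c)) \<in> A" "(0, a * w 0) \<in> A"
    by (auto simp: A_def grid_point_def image_iff intro: exI[of _ "-1"] exI[of _ 0])
  have G: "greatest_convex_minorant A x = l x" if x: "- c \<le> x" "x \<le> 0" for x
  proof (rule antisym)
    have G: "convex_minorant (greatest_convex_minorant A) A" using ts l by (rule convex_minorant_gcm)
    show "greatest_convex_minorant A x \<le> l x"
    \<comment> \<open>At \<open>x = 0\<close> the chord ending at 0 is not admissible, since
      \<open>below_chords\<close> wants \<open>x < q\<close>; the data point at 0 is used
      instead.\<close>
    proof (cases "x = 0")
      case True
      thus ?thesis using G P by (auto simp: convex_minorant_def l_def)
    next
      case False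
      hence "below_chords A x (greatest_convex_minorant A x)"
        using convex_minorant_below_chords[OF G] by simp
      hence "greatest_convex_minorant A x * (0 - - c) \<le> a * w (- c) * (0 - x) + a * w 0 * (x - - c)"
        using P x False unfolding below_chords_def by fastforce
      also have "\<dots> = l x * c" using \<open>c > 0\<close> by (simp add: l_def m_def field_simps)
      finally show ?thesis using \<open>c > 0\<close> by simp
    qed
    show "l x \<le> greatest_convex_minorant A x" using ts l by (rule convex_minorant_le_gcm)
  qed
  have "(l has_real_derivative m) (at_left 0)"
    unfolding l_def by (auto intro!: derivative_eq_intros)
  \<comment> \<open>The filter at 0 from the left sees only points of \<open>(-c, 0)\<close>;
    agreement at 0 itself comes from \<open>G[of 0]\<close>.\<close>
  moreover have "eventually (\<lambda>x. greatest_convex_minorant A x = l x) (at_left 0)"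
    using eventually_at_left_real[of "- c" 0] \<open>c > 0\<close> by (auto elim!: eventually_mono intro!: G)
  ultimately have "(greatest_convex_minorant A has_real_derivative m) (at_left 0)"
    using G[of 0] \<open>c > 0\<close> has_field_derivative_cong_eventually by fastforce
  thus ?thesis unfolding gcm_slope_def A_def m_def by (rule left_derivative_eq)
qed

text \<open>For \<open>k\<close> other than 0 and -1 the drift is at least half of
  \<open>b * c^2 * k^2\<close>. The constant \<open>b / (4 * a)\<close> lets the increment at
  \<open>k\<close> and the extrapolated increment at -1 consume at most a quarter each.\<close>

lemma gcm_slope_eq_first_chord_if_small:
  assumes "c > 0" "a > 0" "b > 0"
    and small: "\<And>k. k \<noteq> 0 \<Longrightarrow> \<bar>w (c * of_int k) - w 0\<bar> \<le> b / (4 * a) * (c\<^sup>2 * (of_int k)\<^sup>2)"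
  shows "gcm_slope w c a b 0 = a * (w 0 - w (- c)) / c"
proof (rule gcm_slope_eq_first_chord)
  fix k :: int
  define v where "v = (\<lambda>k::int. w (c * of_int k) - w 0)"
  have v: "a * \<bar>v k\<bar> \<le> b * c\<^sup>2 * (of_int k)\<^sup>2 / 4" if "k \<noteq> 0" for k
    using small[OF that] \<open>a > 0\<close> by (simp add: v_def field_simps)
  define r where "r = real_of_int k"
  \<comment> \<open>This is the goal with \<open>a * w 0\<close> subtracted; for
    \<open>k = 0\<close> and \<open>k = -1\<close> it is an equality.\<close>
  have "- (a * v (-1) * r) \<le> a * v k + b * c\<^sup>2 * (r * (1 + r))"
  proof (cases "k = 0 \<or> k = -1")
    case True
    thus ?thesis by (auto simp: v_def r_def)
  next
    case False
    hence k: "k \<ge> 1 \<or> k \<le> -2" by linarith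
    hence r: "r \<ge> 1 \<or> r \<le> -2" unfolding r_def by linarith
    hence "\<bar>r\<bar> * 1 \<le> \<bar>r\<bar> * \<bar>r\<bar>" by (intro mult_left_mono) auto
    hence r1: "\<bar>r\<bar> \<le> r\<^sup>2" by (simp add: power2_eq_square)
    \<comment> \<open>Tight at \<open>r = -2\<close>, which is why the drift only dominates half of
      the square.\<close>
    have "0 \<le> r * (r + 2)" using r by (auto simp: zero_le_mult_iff)
    hence r2: "r\<^sup>2 / 2 \<le> r * (1 + r)" by (simp add: power2_eq_square algebra_simps)
    have "- (a * v (-1) * r) \<le> \<bar>a * v (-1) * r\<bar>" by linarith
    also have "\<dots> = a * \<bar>v (-1)\<bar> * \<bar>r\<bar>" using \<open>a > 0\<close> by (simp add: abs_mult)
    \<comment> \<open>The increment at -1 grows linearly along the line, and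
      \<open>\<bar>r\<bar> \<le> r^2\<close> absorbs this growth.\<close>
    also have "\<dots> \<le> (b * c\<^sup>2 / 4) * r\<^sup>2"
      using v[of "-1"] r1 assms by (intro mult_mono) auto
    finally have "- (a * v (-1) * r) \<le> b * c\<^sup>2 * r\<^sup>2 / 4" by simp
    moreover have "- (a * v k) \<le> b * c\<^sup>2 * r\<^sup>2 / 4"
    proof -
      have "- (a * v k) \<le> a * \<bar>v k\<bar>"
        using abs_ge_minus_self[of "a * v k"] \<open>a > 0\<close> by (simp add: abs_mult)
      also have "\<dots> \<le> b * c\<^sup>2 * r\<^sup>2 / 4" unfolding r_def using k by (intro v) auto
      finally show ?thesis .
    qed
    moreover have "b * c\<^sup>2 * (r\<^sup>2 / 2) \<le> b * c\<^sup>2 * (r * (1 + r))"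
      using r2 assms by (intro mult_left_mono) auto
    ultimately show ?thesis by simp
  qed
  thus "a * w 0 + a * (w 0 - w (- c)) * of_int k
      \<le> a * w (c * of_int k) + b * c\<^sup>2 * of_int k * (1 + of_int k)"
    by (simp add: v_def r_def algebra_simps)
qed fact


section \<open>Tail bounds for the Brownian path on the grid\<close>

text \<open>Chebyshev's inequality for a centred increment of variance
  \<open>\<bar>t - s\<bar>\<close>. Its law is given for \<open>s < t\<close>; the other order
  follows by symmetry of the absolute value.\<close>

lemma two_sided_brownian_motion_tail:
  assumes "two_sided_brownian_motion M W" "s \<noteq> t" "e > 0"
  shows "measure M {\<omega> \<in> space M. e \<le> \<bar>W t \<omega> - W s \<omega>\<bar>} \<le> \<bar>t - s\<bar> / e\<^sup>2"
proof -
  interpret prob_space M using assms by (simp add: two_sided_brownian_motion_def)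
  have *: "prob {\<omega> \<in> space M. e \<le> \<bar>W t \<omega> - W s \<omega>\<bar>} \<le> (t - s) / e\<^sup>2" if "s < t" for s t
  proof -
    let ?X = "\<lambda>\<omega>. W t \<omega> - W s \<omega>"
    have D: "distributed M lborel ?X (normal_density 0 (sqrt (t - s)))"
      using assms that by (simp add: two_sided_brownian_motion_def)
    have pos: "0 < sqrt (t - s)" using that by simp
    have "integrable M (\<lambda>\<omega>. (?X \<omega>)\<^sup>2)"
      using integrable_normal_moment[OF pos, of 0 2]
      by (subst distributed_integrable[OF D, symmetric]) auto
    moreover have "random_variable borel ?X" using distributed_measurable[OF D] by simp
    ultimately have "prob {\<omega> \<in> space M. e \<le> \<bar>?X \<omega> - expectation ?X\<bar>} \<le> variance ?X / e\<^sup>2"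
      by (intro Chebyshev_inequality assms)
    thus ?thesis
      using that normal_distributed_variance[OF pos D]
      by (simp add: normal_distributed_expectation[OF pos D])
  qed
  from assms(2) consider "s < t" | "t < s" by linarith
  thus ?thesis using *[of s t] *[of t s] by cases (auto simp: abs_minus_commute)
qed

text \<open>The event at \<open>k\<close> has probability at most
  \<open>c * \<bar>k\<bar> / (e * c^2 * k^2)^2\<close>, which is of order
  \<open>c^-3 * \<bar>k\<bar>^-3\<close> and hence summable over \<open>k\<close>.\<close>

lemma two_sided_brownian_motion_quadratic_bound:
  assumes BM: "two_sided_brownian_motion M W" and "e > 0" "c > 0"
  defines "B \<equiv> {\<omega> \<in> space M. \<exists>k::int. k \<noteq> 0 \<and>
    e * (c\<^sup>2 * (of_int k)\<^sup>2) \<le> \<bar>W (c * of_int k) \<omega> - W 0 \<omega>\<bar>}"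
  shows "B \<in> sets M"
    and "measure M B \<le> (\<Sum>n. 1 / (real (Suc n))\<^sup>2) * (2 / e\<^sup>2) / c ^ 3"
proof -
  interpret prob_space M using BM by (simp add: two_sided_brownian_motion_def)
  have [measurable]: "W t \<in> borel_measurable M" for t
    using BM by (simp add: two_sided_brownian_motion_def)
  show "B \<in> sets M" unfolding B_def by measurable
  define C where "C = (\<lambda>k::int. {\<omega> \<in> space M.
    e * (c\<^sup>2 * (of_int k)\<^sup>2) \<le> \<bar>W (c * of_int k) \<omega> - W 0 \<omega>\<bar>})"
  \<comment> \<open>Pairing \<open>k\<close> with \<open>- k\<close> enumerates the nonzero integers
    by naturals and produces the factor 2.\<close>
  define D where "D = (\<lambda>n. C (int (Suc n)) \<union> C (- int (Suc n)))"
  have [measurable]: "C k \<in> sets M" for k unfolding C_def by measurable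
  have C: "prob (C k) \<le> 1 / (e\<^sup>2 * c ^ 3) / (of_int k)\<^sup>2" if "k \<noteq> 0" for k
  proof -
    define r where "r = real_of_int k"
    have r: "\<bar>r\<bar> \<ge> 1" using that unfolding r_def by linarith
    have "prob (C k) \<le> \<bar>c * r - 0\<bar> / (e * (c\<^sup>2 * r\<^sup>2))\<^sup>2"
      unfolding C_def r_def using assms that by (intro two_sided_brownian_motion_tail BM) auto
    also have "\<dots> = c * \<bar>r\<bar> / (c * (e\<^sup>2 * c ^ 3 * (\<bar>r\<bar> ^ 4)))"
      using \<open>c > 0\<close> by (simp add: abs_mult power_mult_distrib flip: power_mult)
         (simp add: eval_nat_numeral)
    also have "\<dots> = \<bar>r\<bar> / (e\<^sup>2 * c ^ 3 * (\<bar>r\<bar> ^ 4))" using \<open>c > 0\<close> by simp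
    \<comment> \<open>Weakens the cubic decay in \<open>k\<close> to the inverse squares, whose
      series is known to converge.\<close>
    also have "\<dots> \<le> \<bar>r\<bar>\<^sup>2 / (e\<^sup>2 * c ^ 3 * (\<bar>r\<bar> ^ 4))"
      using r \<open>c > 0\<close> self_le_power[of "\<bar>r\<bar>" 2] by (intro divide_right_mono) auto
    also have "\<dots> = 1 / (e\<^sup>2 * c ^ 3) / r\<^sup>2"
    proof -
      have r4: "\<bar>r\<bar> ^ 4 = r\<^sup>2 * r\<^sup>2" by (simp add: eval_nat_numeral)
      have "q / (d * (q * q)) = 1 / d / q" for q d :: real by simp
      from this[of "r\<^sup>2"] show ?thesis unfolding r4 by simp
    qed
    finally show ?thesis by (simp add: r_def)
  qed
  have D_le: "prob (D n) \<le> 2 / (e\<^sup>2 * c ^ 3) * (1 / (real (Suc n))\<^sup>2)" for n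
  proof -
    have "prob (D n) \<le> prob (C (int (Suc n))) + prob (C (- int (Suc n)))"
      unfolding D_def by (rule measure_Un_le) auto
    also have "\<dots> \<le> 1 / (e\<^sup>2 * c ^ 3) / (of_int (int (Suc n)))\<^sup>2 + 1 / (e\<^sup>2 * c ^ 3) / (of_int (- int (Suc n)))\<^sup>2"
      by (intro add_mono C) auto
    also have "\<dots> = 2 / (e\<^sup>2 * c ^ 3) * (1 / (real (Suc n))\<^sup>2)"
      by (simp del: of_nat_Suc)
    finally show ?thesis .
  qed
  have summable: "summable (\<lambda>n. 1 / (real (Suc n))\<^sup>2)"
    using inverse_power_summable[of 2, where 'a = real] by (subst summable_Suc_iff) (simp add: inverse_eq_divide)
  hence summable': "summable (\<lambda>n. 2 / (e\<^sup>2 * c ^ 3) * (1 / (real (Suc n))\<^sup>2))"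
    by (rule summable_mult)
  have summable_D: "summable (\<lambda>n. prob (D n))"
    by (rule summable_comparison_test'[OF summable', of 0]) (use D_le in auto)
  have "B \<subseteq> (\<Union>n. D n)"
  proof
    fix \<omega> assume "\<omega> \<in> B"
    then obtain k where k: "k \<noteq> 0" "\<omega> \<in> C k" by (auto simp: B_def C_def)
    obtain n where "k = int (Suc n) \<or> k = - int (Suc n)"
      using k(1) by (cases k rule: int_cases3) (metis Suc_pred)+
    thus "\<omega> \<in> (\<Union>n. D n)" using k(2) by (auto simp: D_def)
  qed
  hence "prob B \<le> prob (\<Union>n. D n)" by (intro finite_measure_mono) (auto simp: D_def)
  also have "\<dots> \<le> (\<Sum>n. prob (D n))"
    by (rule finite_measure_subadditive_countably[OF _ summable_D]) (auto simp: D_def)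
  also have "\<dots> \<le> (\<Sum>n. 2 / (e\<^sup>2 * c ^ 3) * (1 / (real (Suc n))\<^sup>2))"
    by (rule suminf_le[OF D_le summable_D summable'])
  also have "\<dots> = 2 / (e\<^sup>2 * c ^ 3) * (\<Sum>n. 1 / (real (Suc n))\<^sup>2)"
    by (rule suminf_mult[OF summable])
  finally show "measure M B \<le> (\<Sum>n. 1 / (real (Suc n))\<^sup>2) * (2 / e\<^sup>2) / c ^ 3"
    by (simp add: mult_ac)
qed

section \<open>Comparison of laws and the limit\<close>

text \<open>A coupling bound: the event \<open>X \<le> x\<close> is contained in the union of
  \<open>Y \<le> x\<close> and \<open>B\<close>, and the roles of \<open>X\<close> and
  \<open>Y\<close> can be exchanged.\<close>

lemma (in prob_space) cdf_distr_diff_le: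
  assumes [measurable]: "random_variable borel X" "random_variable borel Y" "B \<in> events"
    and eq: "\<And>\<omega>. \<omega> \<in> space M \<Longrightarrow> \<omega> \<notin> B \<Longrightarrow> X \<omega> = Y \<omega>"
  shows "\<bar>cdf (distr M borel X) x - cdf (distr M borel Y) x\<bar> \<le> prob B"
proof -
  have *: "cdf (distr M borel X) x \<le> cdf (distr M borel Y) x + prob B"
    if [measurable]: "random_variable borel X" "random_variable borel Y"
      and eq: "\<And>\<omega>. \<omega> \<in> space M \<Longrightarrow> \<omega> \<notin> B \<Longrightarrow> X \<omega> = Y \<omega>" for X Y :: "'a \<Rightarrow> real"
  proof -
    have "prob (X -` {..x} \<inter> space M) \<le> prob ((Y -` {..x} \<inter> space M) \<union> B)"
      by (intro finite_measure_mono) (use eq in auto)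
    also have "\<dots> \<le> prob (Y -` {..x} \<inter> space M) + prob B"
      by (intro measure_Un_le) auto
    finally show ?thesis by (simp add: cdf_def measure_distr)
  qed
  show ?thesis using *[of X Y] *[of Y X] assms by (auto simp: abs_le_iff)
qed

text \<open>Identifies both laws compared in the theorem: \<open>\<alpha> / sqrt c\<close> times an
  increment of standard deviation \<open>sqrt c\<close>, and \<open>\<alpha>\<close> times a
  standard normal variable.\<close>

lemma distributed_scaled_normal:
  assumes "prob_space M" "distributed M lborel X (normal_density 0 s)" "s > 0" "a > 0"
  shows "distr M borel (\<lambda>\<omega>. a * X \<omega>) = density lborel (normal_density 0 (a * s))"
proof -
  have "distributed M lborel (\<lambda>\<omega>. a * X \<omega>) (normal_density 0 (a * s))"
    using prob_space.normal_density_affine[OF assms(1,2,3), of a 0] assms(4) by simp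
  from distributed_distr_eq_density[OF this] show ?thesis
    by (metis distr_cong sets_lborel)
qed

theorem theorem4p1:
  fixes F f g :: "real \<Rightarrow> real" and x\<^sub>0 \<alpha> \<beta> :: real
    and M :: "'a measure" and W :: "real \<Rightarrow> 'a \<Rightarrow> real"
    and S :: "real \<Rightarrow> 'a \<Rightarrow> real"
    and N :: "'b measure" and Z :: "'b \<Rightarrow> real"
  assumes "dist_fun_with_density F f" and "prob_density g"
    and "0 < F x\<^sub>0" and "F x\<^sub>0 < 1" and "f x\<^sub>0 > 0" and "g x\<^sub>0 > 0"
    and "\<alpha> = sqrt (F x\<^sub>0 * (1 - F x\<^sub>0) / g x\<^sub>0)"
    and "\<beta> = f x\<^sub>0 / 2"
    and "two_sided_brownian_motion M W"
    and "\<And>c \<omega>. c > 0 \<Longrightarrow> \<omega> \<in> space M \<Longrightarrow> S c \<omega> = gcm_slope (\<lambda>t. W t \<omega>) c \<alpha> \<beta> 0"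
    and "prob_space N"
    and "distributed N lborel Z std_normal_density"
  shows "weak_conv_along at_top
           (\<lambda>c. distr M borel (\<lambda>\<omega>. sqrt c * S c \<omega>))
           (distr N borel (\<lambda>z. \<alpha> * Z z))"
proof -
  note BM = \<open>two_sided_brownian_motion M W\<close>
  interpret prob_space M using BM by (simp add: two_sided_brownian_motion_def)
  have W[measurable]: "W t \<in> borel_measurable M" for t
    using BM by (simp add: two_sided_brownian_motion_def)
  have "\<alpha> > 0" "\<beta> > 0" using assms by auto
  \<comment> \<open>The threshold demanded by
    \<open>gcm_slope_eq_first_chord_if_small\<close>.\<close>
  define e where "e = \<beta> / (4 * \<alpha>)"
  define K where "K = (\<Sum>n. 1 / (real (Suc n))\<^sup>2) * (2 / e\<^sup>2)"
  define \<nu> where "\<nu> = distr N borel (\<lambda>z. \<alpha> * Z z)"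
  have "e > 0" using \<open>\<alpha> > 0\<close> \<open>\<beta> > 0\<close> by (simp add: e_def)
  \<comment> \<open>\<open>K\<close> depends on neither \<open>c\<close> nor \<open>x\<close>, so
    the distribution functions approach each other uniformly at rate \<open>c^-3\<close>.\<close>
  have bound: "\<bar>cdf (distr M borel (\<lambda>\<omega>. sqrt c * S c \<omega>)) x - cdf \<nu> x\<bar> \<le> K / c ^ 3"
    if "c > 0" for c x
  proof -
    define B where "B = {\<omega> \<in> space M. \<exists>k::int. k \<noteq> 0 \<and>
      e * (c\<^sup>2 * (of_int k)\<^sup>2) \<le> \<bar>W (c * of_int k) \<omega> - W 0 \<omega>\<bar>}"
    \<comment> \<open>\<open>Y\<close> is \<open>sqrt c\<close> times the slope of the first chord;
      its law is exactly the limit law for every \<open>c > 0\<close>.\<close>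
    define Y where "Y = (\<lambda>\<omega>. \<alpha> / sqrt c * (W 0 \<omega> - W (- c) \<omega>))"
    have B: "B \<in> sets M" "prob B \<le> K / c ^ 3"
      unfolding B_def K_def
      using two_sided_brownian_motion_quadratic_bound[OF BM \<open>e > 0\<close> \<open>c > 0\<close>] by simp_all
    have "distributed M lborel (\<lambda>\<omega>. W 0 \<omega> - W (- c) \<omega>) (normal_density 0 (sqrt (0 - - c)))"
      using BM \<open>c > 0\<close> unfolding two_sided_brownian_motion_def by (meson neg_less_0_iff_less)
    hence "distributed M lborel (\<lambda>\<omega>. W 0 \<omega> - W (- c) \<omega>) (normal_density 0 (sqrt c))" by simp
    hence "distr M borel Y = density lborel (normal_density 0 (\<alpha> / sqrt c * sqrt c))"
      unfolding Y_def using \<open>c > 0\<close> \<open>\<alpha> > 0\<close>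
      by (intro distributed_scaled_normal) (auto intro: prob_space_axioms)
    \<comment> \<open>The form \<open>\<alpha> * 1\<close> matches the scaling lemma at standard
      deviation 1.\<close>
    also have "\<alpha> / sqrt c * sqrt c = \<alpha> * 1" using \<open>c > 0\<close> by simp
    also have "density lborel (normal_density 0 (\<alpha> * 1)) = \<nu>"
      unfolding \<nu>_def using assms(11,12) \<open>\<alpha> > 0\<close> by (intro distributed_scaled_normal[symmetric]) auto
    finally have Y: "distr M borel Y = \<nu>" .
    \<comment> \<open>\<open>S c\<close> is prescribed only on \<open>space M\<close>, which
      suffices for measurability.\<close>
    have "S c \<in> borel_measurable M \<longleftrightarrow> (\<lambda>\<omega>. gcm_slope (\<lambda>t. W t \<omega>) c \<alpha> \<beta> 0) \<in> borel_measurable M"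
      using assms(10) \<open>c > 0\<close> by (intro measurable_cong) auto
    hence [measurable]: "S c \<in> borel_measurable M"
      using measurable_gcm_slope[OF W \<open>c > 0\<close>] by simp
    have "sqrt c * S c \<omega> = Y \<omega>" if \<omega>: "\<omega> \<in> space M" "\<omega> \<notin> B" for \<omega>
    proof -
      have "gcm_slope (\<lambda>t. W t \<omega>) c \<alpha> \<beta> 0 = \<alpha> * (W 0 \<omega> - W (- c) \<omega>) / c"
        by (rule gcm_slope_eq_first_chord_if_small)
           (use \<omega> \<open>c > 0\<close> \<open>\<alpha> > 0\<close> \<open>\<beta> > 0\<close> in \<open>auto simp: B_def e_def not_le intro: less_imp_le\<close>)
      moreover have "sqrt c / c = 1 / sqrt c"
        using \<open>c > 0\<close> by (simp add: field_simps)
      ultimately show ?thesis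
        using assms(10)[OF \<open>c > 0\<close> \<omega>(1)]
        by (metis Y_def mult.commute mult.left_commute times_divide_eq_left times_divide_eq_right mult_1)
    qed
    hence "\<bar>cdf (distr M borel (\<lambda>\<omega>. sqrt c * S c \<omega>)) x - cdf (distr M borel Y) x\<bar> \<le> prob B"
      using B(1) by (intro cdf_distr_diff_le) (auto simp: Y_def)
    thus ?thesis using B(2) by (simp add: Y)
  qed
  have lim: "((\<lambda>c. K / c ^ 3) \<longlongrightarrow> 0) at_top"
    by (intro real_tendsto_divide_at_top[OF tendsto_const] filterlim_pow_at_top filterlim_ident) auto
  have "((\<lambda>c. cdf (distr M borel (\<lambda>\<omega>. sqrt c * S c \<omega>)) x) \<longlongrightarrow> cdf \<nu> x) at_top" for x
  proof (rule Lim_transform2[OF tendsto_const])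
    show "((\<lambda>c. cdf \<nu> x - cdf (distr M borel (\<lambda>\<omega>. sqrt c * S c \<omega>)) x) \<longlongrightarrow> 0) at_top"
      using lim
    proof (rule Lim_null_comparison[rotated])
      show "\<forall>\<^sub>F c in at_top. norm (cdf \<nu> x - cdf (distr M borel (\<lambda>\<omega>. sqrt c * S c \<omega>)) x) \<le> K / c ^ 3"
        using eventually_gt_at_top[of 0]
        by eventually_elim (use bound in \<open>simp add: abs_minus_commute\<close>)
    qed
  qed
  thus ?thesis by (simp add: weak_conv_along_def \<nu>_def)
qed

end
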